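(* Let $m\ge 1$ be an integer and let $\rho\in[0,1]$. Consider the deterministic Fukui–Ishibashi traffic cellular automaton with maximum speed $m$ on the infinite lattice $\mathbb{Z}$, started at time $0$ from a random configuration in which the sites are independently occupied with probability $\rho$ and empty with probability $1-\rho$. Let $P_t(0^{m+1})$ be the probability that $m+1$ given consecutive sites are all empty at time $t$, and let $\phi_m(t)$ be the average flow at time $t$. Then $$\lim_{t\to\infty}P_t(0^{m+1})=\begin{cases}1-(m+1)\rho & \text{if }\rho<1/(m+1),\\ 0 & \text{otherwise,}\end{cases}$$ and $$\lim_{t\to\infty}\phi_m(t)=\begin{cases}m\rho & \text{if }\rho<1/(m+1),\\ 1-\rho & \text{otherwise.}\end{cases}$$
   Context: Dynamics. A configuration at time $t$ is $s(\cdot,t):\mathbb{Z}\to\{0,1\}$, where $s(i,t)=1$ means site $i$ is occupied by a car and $s(i,t)=0$ means it is empty. At each time step all cars move simultaneously to the right: a car at site $x$ with $g$ empty sites between it and the next car ahead ($g=\infty$ if there is no car ahead) moves to $x+\min(g,m)$. Equivalently, $s(i,t+1)=f_m(s(i-m,t),\dots,s(i+1,t))$, where $s(i,t+1)=1$ if and only if either (a) $s(i,t)=1$ and $s(i+1,t)=1$, or (b) $s(i,t)=0$ and there is $1\le j\le m$ with $s(i-j,t)=1$, $s(i-j+1,t)=\dots=s(i,t)=0$, and ($j=m$ or $s(i+1,t)=1$). Block probabilities. For a finite binary word $b=b_1\cdots b_r$, $P_t(b)$ is the probability that $s(i,t)s(i+1,t)\cdots s(i+r-1,t)=b$ (independent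 of $i$ by translation invariance). $0^k$ denotes $k$ consecutive zeros. Average flow. $\phi_m(t)=\rho\,\overline v(t)$ is the density times the average velocity of the cars at time $t$, the velocity of a car with gap $g$ ahead being $\min(g,m)$; in terms of block probabilities, $$\phi_m(t)=\sum_{k=1}^{m-1}k\,P_t(10^k1)+m\,P_t(10^m).$$ *)

theory Defs
  imports "HOL-Probability.Probability"
begin

text \<open>Configurations are functions \<open>s :: int \<Rightarrow> bool\<close>; \<open>True\<close> encodes \<open>1\<close> (occupied by a car),
  \<open>False\<close> encodes \<open>0\<close> (empty).\<close>

definition fi_step :: "nat \<Rightarrow> (int \<Rightarrow> bool) \<Rightarrow> (int \<Rightarrow> bool)" where
  "fi_step m s i \<longleftrightarrow>
     s i \<and> s (i + 1) \<or>
     \<not> s i \<and> (\<exists>j\<in>{1..m}. s (i - int j) \<and> (\<forall>k<j. \<not> s (i - int k)) \<and> (j = m \<or> s (i + 1)))"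

definition initial_measure :: "real \<Rightarrow> (int \<Rightarrow> bool) measure" where
  "initial_measure \<rho> = Pi\<^sub>M UNIV (\<lambda>_. measure_pmf (bernoulli_pmf \<rho>))"

definition occurs_at :: "bool list \<Rightarrow> (int \<Rightarrow> bool) \<Rightarrow> int \<Rightarrow> bool" where
  "occurs_at b s i \<longleftrightarrow> (\<forall>k<length b. s (i + int k) = b ! k)"

text \<open>Block probabilities are read off at the origin; lemma \<open>block_prob_at\<close> below shows that any
  other site gives the same value.\<close>

definition block_prob :: "nat \<Rightarrow> real \<Rightarrow> nat \<Rightarrow> bool list \<Rightarrow> real" where
  "block_prob m \<rho> t b =
     measure (initial_measure \<rho>)
       {s \<in> space (initial_measure \<rho>). occurs_at b ((fi_step m ^^ t) s) 0}"

definition average_flow :: "nat \<Rightarrow> real \<Rightarrow> nat \<Rightarrow> real" where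
  "average_flow m \<rho> t =
     (\<Sum>k\<in>{1..<m}. real k * block_prob m \<rho> t ([True] @ replicate k False @ [True])) +
     real m * block_prob m \<rho> t ([True] @ replicate m False)"


text \<open>The local rule agrees with the description by moving cars. If there is no car ahead, the
  infimum is over the empty set, so the gap is \<open>\<infinity>\<close>.\<close>

definition gap :: "(int \<Rightarrow> bool) \<Rightarrow> int \<Rightarrow> enat" where
  "gap s x = (INF y\<in>{y. x < y \<and> s y}. enat (nat (y - x - 1)))"

definition velocity :: "nat \<Rightarrow> (int \<Rightarrow> bool) \<Rightarrow> int \<Rightarrow> nat" where
  "velocity m s x = the_enat (min (gap s x) (enat m))"

lemma le_gap_iff: "enat k \<le> gap s x \<longleftrightarrow> (\<forall>y. x < y \<and> y \<le> x + int k \<longrightarrow> \<not> s y)"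
proof -
  have "enat k \<le> gap s x \<longleftrightarrow> (\<forall>y. x < y \<and> s y \<longrightarrow> k \<le> nat (y - x - 1))"
    unfolding gap_def by (auto simp: le_INF_iff)
  also have "\<dots> \<longleftrightarrow> (\<forall>y. x < y \<and> y \<le> x + int k \<longrightarrow> \<not> s y)"
  proof -
    have "k \<le> nat (y - x - 1) \<longleftrightarrow> \<not> y \<le> x + int k" if "x < y" for y
      using that by linarith
    then show ?thesis by blast
  qed
  finally show ?thesis .
qed

lemma enat_velocity: "enat (velocity m s x) = min (gap s x) (enat m)"
  unfolding velocity_def by (cases "gap s x") (auto simp: min_def)

lemma le_velocity_iff: "k \<le> velocity m s x \<longleftrightarrow> k \<le> m \<and> enat k \<le> gap s x"
proof -
  have "k \<le> velocity m s x \<longleftrightarrow> enat k \<le> min (gap s x) (enat m)"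
    by (simp flip: enat_velocity)
  then show ?thesis by auto
qed

lemma velocity_eq_iff:
  "velocity m s x = v \<longleftrightarrow>
     v \<le> m \<and> (\<forall>y. x < y \<and> y \<le> x + int v \<longrightarrow> \<not> s y) \<and> (v = m \<or> s (x + int v + 1))"
proof -
  have "velocity m s x = v \<longleftrightarrow> v \<le> velocity m s x \<and> \<not> Suc v \<le> velocity m s x"
    by linarith
  also have "\<dots> \<longleftrightarrow> v \<le> m \<and> enat v \<le> gap s x \<and> (v = m \<or> \<not> enat (Suc v) \<le> gap s x)"
    unfolding le_velocity_iff by auto
  also have "\<dots> \<longleftrightarrow> v \<le> m \<and> (\<forall>y. x < y \<and> y \<le> x + int v \<longrightarrow> \<not> s y) \<and> (v = m \<or> s (x + int v + 1))"
  proof -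
    have "(\<forall>y. x < y \<and> y \<le> x + int (Suc v) \<longrightarrow> \<not> s y) \<longleftrightarrow>
          (\<forall>y. x < y \<and> y \<le> x + int v \<longrightarrow> \<not> s y) \<and> \<not> s (x + int v + 1)"
    proof -
      have "x < y \<and> y \<le> x + int (Suc v) \<longleftrightarrow> (x < y \<and> y \<le> x + int v) \<or> y = x + int v + 1" for y
        by auto
      then show ?thesis by blast
    qed
    then show ?thesis unfolding le_gap_iff by blast
  qed
  finally show ?thesis .
qed

lemma fi_step_iff_car_motion:
  assumes "m \<ge> 1"
  shows "fi_step m s i \<longleftrightarrow> (\<exists>x. s x \<and> x + int (velocity m s x) = i)"
proof
  assume "fi_step m s i"
  then consider "s i" "s (i + 1)"
    | j where "1 \<le> j" "j \<le> m" "s (i - int j)" "\<forall>k<j. \<not> s (i - int k)" "j = m \<or> s (i + 1)"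
    unfolding fi_step_def by auto
  then show "\<exists>x. s x \<and> x + int (velocity m s x) = i"
  proof cases
    case 1
    then have "velocity m s i = 0" by (auto simp: velocity_eq_iff)
    with 1 show ?thesis by (intro exI[of _ i]) simp
  next
    case 2
    have "\<not> s y" if "i - int j < y" "y \<le> i" for y
      using 2(4)[rule_format, of "nat (i - y)"] that by auto
    with 2 have "velocity m s (i - int j) = j" by (auto simp: velocity_eq_iff)
    with 2 show ?thesis by (intro exI[of _ "i - int j"]) simp
  qed
next
  assume "\<exists>x. s x \<and> x + int (velocity m s x) = i"
  then obtain x v where x: "s x" "x + int v = i" "velocity m s x = v" by blast
  from x(3) have v: "v \<le> m" "\<And>y. x < y \<Longrightarrow> y \<le> i \<Longrightarrow> \<not> s y" "v = m \<or> s (i + 1)"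
    using x(2) by (auto simp: velocity_eq_iff)
  show "fi_step m s i"
  proof (cases "v = 0")
    case True
    with v x assms show ?thesis by (auto simp: fi_step_def)
  next
    case False
    have "\<not> s (i - int k)" if "k < v" for k using that x by (intro v(2)) auto
    moreover have "i - int v = x" using x by simp
    moreover have "\<not> s i" using v(2)[of i] False x(2) by auto
    moreover have "v \<in> {1..m}" using v(1) False by auto
    ultimately show ?thesis
      unfolding fi_step_def using v(3) x(1) by blast
  qed
qed


lemma space_initial_measure [simp]: "space (initial_measure \<rho>) = UNIV"
  by (simp add: initial_measure_def space_PiM)

lemma prob_space_initial_measure: "prob_space (initial_measure \<rho>)"
  unfolding initial_measure_def by (intro prob_space_PiM measure_pmf.prob_space_axioms)

lemma measurable_site [measurable]:
  "(\<lambda>s. s i) \<in> measurable (initial_measure \<rho>) (count_space UNIV)"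
proof -
  have "(\<lambda>s. s i) \<in> measurable (initial_measure \<rho>) (measure_pmf (bernoulli_pmf \<rho>))"
    unfolding initial_measure_def by (rule measurable_component_singleton) simp
  then show ?thesis by simp
qed

lemma measurable_fi_step:
  assumes [measurable]: "\<And>i. Measurable.pred M (\<lambda>x. S x i)"
  shows "Measurable.pred M (\<lambda>x. fi_step m (S x) i)"
  unfolding fi_step_def by measurable

lemma measurable_fi_step_site [measurable]:
  "(\<lambda>s. (fi_step m ^^ t) s i) \<in> measurable (initial_measure \<rho>) (count_space UNIV)"
proof (induction t arbitrary: i)
  case 0
  then show ?case by simp
next
  case (Suc t)
  show ?case
    using measurable_fi_step[OF Suc.IH] by simp
qed

lemma sets_occurs_at:
  "{s \<in> space (initial_measure \<rho>). occurs_at b ((fi_step m ^^ t) s) i} \<in> sets (initial_measure \<rho>)"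
  unfolding occurs_at_def by measurable

lemma fi_step_shift: "fi_step m (\<lambda>k. s (k + i)) j = fi_step m s (j + i)"
proof -
  have *: "j + 1 + i = j + i + 1" "\<And>k. j - int k + i = j + i - int k" by auto
  show ?thesis unfolding fi_step_def * by (rule refl)
qed

lemma fi_steps_shift: "(fi_step m ^^ t) (\<lambda>k. s (k + i)) = (\<lambda>j. (fi_step m ^^ t) s (j + i))"
proof (induction t)
  case (Suc t)
  have "(fi_step m ^^ Suc t) (\<lambda>k. s (k + i)) = fi_step m (\<lambda>j. (fi_step m ^^ t) s (j + i))"
    using Suc.IH by simp
  also have "\<dots> = (\<lambda>j. fi_step m ((fi_step m ^^ t) s) (j + i))"
    by (rule ext) (rule fi_step_shift)
  finally show ?case by simp
qed simp

lemma distr_initial_measure_shift: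
  "distr (initial_measure \<rho>) (initial_measure \<rho>) (\<lambda>s k. s (k + i)) = initial_measure \<rho>"
proof -
  have "distr (Pi\<^sub>M UNIV (\<lambda>_. measure_pmf (bernoulli_pmf \<rho>)))
          (Pi\<^sub>M UNIV (\<lambda>_::int. measure_pmf (bernoulli_pmf \<rho>)))
          (\<lambda>\<omega>. \<lambda>n\<in>UNIV. \<omega> (n + i)) = Pi\<^sub>M UNIV (\<lambda>_. measure_pmf (bernoulli_pmf \<rho>))"
    by (rule distr_PiM_reindex) (auto simp: measure_pmf.prob_space_axioms)
  then show ?thesis by (simp add: initial_measure_def restrict_def)
qed

lemma block_prob_at:
  "measure (initial_measure \<rho>)
     {s \<in> space (initial_measure \<rho>). occurs_at b ((fi_step m ^^ t) s) i} = block_prob m \<rho> t b"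
proof -
  let ?A = "{s \<in> space (initial_measure \<rho>). occurs_at b ((fi_step m ^^ t) s) 0}"
  have meas: "(\<lambda>s k. s (k + i)) \<in> measurable (initial_measure \<rho>) (initial_measure \<rho>)"
    by (subst (2) initial_measure_def, rule measurable_PiM_single') auto
  have "block_prob m \<rho> t b =
      measure (distr (initial_measure \<rho>) (initial_measure \<rho>) (\<lambda>s k. s (k + i))) ?A"
    by (simp add: block_prob_def distr_initial_measure_shift)
  also have "\<dots> = measure (initial_measure \<rho>)
      ((\<lambda>s k. s (k + i)) -` ?A \<inter> space (initial_measure \<rho>))"
    by (rule measure_distr[OF meas sets_occurs_at])
  also have "(\<lambda>s k. s (k + i)) -` ?A \<inter> space (initial_measure \<rho>) =
      {s \<in> space (initial_measure \<rho>). occurs_at b ((fi_step m ^^ t) s) i}"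
  proof -
    have "occurs_at b ((fi_step m ^^ t) (\<lambda>k. s (k + i))) 0 \<longleftrightarrow> occurs_at b ((fi_step m ^^ t) s) i" for s
      unfolding fi_steps_shift occurs_at_def by (simp add: add.commute)
    then show ?thesis by auto
  qed
  finally show ?thesis by simp
qed


text \<open>The block formula for the flow is the mean, per site, of the velocity of the car located
  there (zero if there is none), that is, density times average velocity.\<close>

lemma occurs_at_gap_block:
  "occurs_at ([True] @ replicate k False @ [True]) s 0 \<longleftrightarrow>
     s 0 \<and> (\<forall>y. 0 < y \<and> y \<le> int k \<longrightarrow> \<not> s y) \<and> s (int k + 1)" (is ?A)
  and occurs_at_free_block:
  "occurs_at ([True] @ replicate k False) s 0 \<longleftrightarrow>
     s 0 \<and> (\<forall>y. 0 < y \<and> y \<le> int k \<longrightarrow> \<not> s y)" (is ?B)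
proof -
  have *: "(\<forall>y. 0 < y \<and> y \<le> int k \<longrightarrow> \<not> s y) \<longleftrightarrow> (\<forall>n<k. \<not> s (1 + int n))"
  proof (intro iffI allI impI)
    fix y assume *: "\<forall>n<k. \<not> s (1 + int n)" and y: "0 < y \<and> y \<le> int k"
    from y have "nat (y - 1) < k" by linarith
    with * have "\<not> s (1 + int (nat (y - 1)))" by blast
    with y show "\<not> s y" by simp
  qed auto
  have "occurs_at ([True] @ replicate k False @ [True]) s 0 \<longleftrightarrow>
      (\<forall>n<Suc (Suc k). s (int n) = (True # replicate k False @ [True]) ! n)"
    by (simp add: occurs_at_def)
  also have "\<dots> \<longleftrightarrow>
      s 0 \<and> (\<forall>n<Suc k. s (1 + int n) = (replicate k False @ [True]) ! n)"
    by (subst All_less_Suc2) simp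
  also have "\<dots> \<longleftrightarrow> s 0 \<and> (\<forall>n<k. \<not> s (1 + int n)) \<and> s (int k + 1)"
    by (subst All_less_Suc) (auto simp: nth_append add.commute)
  finally show ?A unfolding * .
  have "occurs_at ([True] @ replicate k False) s 0 \<longleftrightarrow>
      (\<forall>n<Suc k. s (int n) = (True # replicate k False) ! n)"
    by (simp add: occurs_at_def)
  also have "\<dots> \<longleftrightarrow> s 0 \<and> (\<forall>n<k. \<not> s (1 + int n))"
    by (subst All_less_Suc2) simp
  finally show ?B unfolding * .
qed

lemma average_flow_eq_expectation:
  "average_flow m \<rho> t =
     prob_space.expectation (initial_measure \<rho>)
       (\<lambda>s. let s' = (fi_step m ^^ t) s in if s' 0 then real (velocity m s' 0) else 0)"
proof -
  interpret prob_space "initial_measure \<rho>" by (rule prob_space_initial_measure)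
  define A where "A b = {s \<in> space (initial_measure \<rho>). occurs_at b ((fi_step m ^^ t) s) 0}" for b
  have [measurable]: "A b \<in> events" for b unfolding A_def by (rule sets_occurs_at)
  let ?g = "\<lambda>k. [True] @ replicate k False @ [True]"
  let ?h = "[True] @ replicate m False"
  have eq: "(let s' = (fi_step m ^^ t) s in if s' 0 then real (velocity m s' 0) else 0) =
      (\<Sum>k\<in>{1..<m}. real k * indicator (A (?g k)) s) + real m * indicator (A ?h) s" for s
  proof -
    define s' where "s' = (fi_step m ^^ t) s"
    have g: "indicator (A (?g k)) s = (if s' 0 \<and> velocity m s' 0 = k then 1 else 0 :: real)"
      if "k < m" for k
      using that unfolding A_def indicator_def
      by (simp add: occurs_at_gap_block[simplified] velocity_eq_iff flip: s'_def)
    have h: "indicator (A ?h) s = (if s' 0 \<and> velocity m s' 0 = m then 1 else 0 :: real)"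
      unfolding A_def indicator_def
      by (simp add: occurs_at_free_block[simplified] velocity_eq_iff flip: s'_def)
    have le: "velocity m s' 0 \<le> m" using velocity_eq_iff by blast
    have "(\<Sum>k\<in>{1..<m}. real k * indicator (A (?g k)) s) =
          (\<Sum>k\<in>{1..<m}. if velocity m s' 0 = k then (if s' 0 then real k else 0) else 0)"
      using g by (intro sum.cong) auto
    also have "\<dots> = (if velocity m s' 0 \<in> {1..<m} \<and> s' 0 then real (velocity m s' 0) else 0)"
      by (subst sum.delta') auto
    finally show ?thesis using le unfolding h by (auto simp flip: s'_def)
  qed
  have "expectation (\<lambda>s. (\<Sum>k\<in>{1..<m}. real k * indicator (A (?g k)) s) + real m * indicator (A ?h) s)
      = average_flow m \<rho> t"
  proof -
    have ind: "integrable (initial_measure \<rho>) (\<lambda>s. c * indicator (A b) s)" for c :: real and b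
      by (intro integrable_mult_right integrable_real_indicator) (simp_all add: emeasure_eq_measure)
    have int: "expectation (\<lambda>s. c * indicator (A b) s) = c * prob (A b)" for c :: real and b
      by simp
    show ?thesis
      unfolding average_flow_def block_prob_def A_def[symmetric]
      by (subst Bochner_Integration.integral_add[OF Bochner_Integration.integrable_sum[OF ind] ind],
          subst Bochner_Integration.integral_sum[OF ind], unfold int, rule refl)
  qed
  then show ?thesis by (simp only: eq)
qed

end

theory Submission
  imports Defs
begin

text \<open>Tracing the rule backwards, the block \<open>0\<^sup>m\<^sup>+\<^sup>1\<close> is present at time \<open>t\<close> iff, in the initial window of
  \<open>(m + 1) (t + 1)\<close> sites that determines it, the first \<open>(m + 1) k\<close> sites contain fewer than \<open>k\<close>
  cars, for every \<open>1 \<le> k \<le> t + 1\<close>. Read from the right end of the window, this says that the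
  random walk with steps \<open>1 - (number of cars in m + 1 sites)\<close> attains a strict record at time
  \<open>t + 1\<close>. The walk goes up by at most one per step, so its maximum up to time \<open>N\<close> equals the number
  of records, and the sum of the first \<open>N\<close> block probabilities is the expected maximum. By
  Hoeffding's inequality this is asymptotic to \<open>N max(0, 1 - (m + 1) \<rho>)\<close>, and the block
  probabilities decrease in \<open>t\<close>, so they converge to the same limit as their averages. The flow
  telescopes to \<open>1 - \<rho> - P\<^sub>t(0\<^sup>m\<^sup>+\<^sup>1)\<close> by conservation of the density.\<close>

section \<open>Empty blocks traced back to the initial configuration\<close>

definition cars :: "(int \<Rightarrow> bool) \<Rightarrow> int \<Rightarrow> nat \<Rightarrow> int" where
  "cars s a n = (\<Sum>k<n. of_bool (s (a + int k)))"

lemma cars_0 [simp]: "cars s a 0 = 0"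
  by (simp add: cars_def)

lemma cars_nonneg: "0 \<le> cars s a n"
  by (auto simp: cars_def intro!: sum_nonneg)

lemma cars_add: "cars s a (n + l) = cars s a n + cars s (a + int n) l"
  by (induction l) (simp_all add: cars_def algebra_simps)

lemma occurs_at_zeros: "occurs_at (replicate n False) s a \<longleftrightarrow> (\<forall>k<n. \<not> s (a + int k))"
  by (auto simp: occurs_at_def)

lemma cars_eq_0_iff: "cars s a n = 0 \<longleftrightarrow> occurs_at (replicate n False) s a"
  unfolding cars_def occurs_at_zeros by (subst sum_nonneg_eq_0_iff) auto

abbreviation clear :: "nat \<Rightarrow> (int \<Rightarrow> bool) \<Rightarrow> int \<Rightarrow> bool" where
  "clear m s a \<equiv> occurs_at (replicate (m + 1) False) s a"

text \<open>The rule \<open>fi_step\<close> looks left from \<open>x\<close>, hence this indexing of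
  the block from its right end.\<close>

lemma clear_iff: "clear m s (x - int m) \<longleftrightarrow> (\<forall>k\<le>m. \<not> s (x - int k))"
proof -
  have "(\<forall>k<m+1. \<not> s (x - int m + int k)) \<longleftrightarrow> (\<forall>k\<le>m. \<not> s (x - int k))"
  proof (intro iffI allI impI)
    fix k assume *: "\<forall>k<m+1. \<not> s (x - int m + int k)" "k \<le> m"
    show "\<not> s (x - int k)" using *(1)[rule_format, of "m - k"] *(2) by (simp add: of_nat_diff)
  next
    fix k assume *: "\<forall>k\<le>m. \<not> s (x - int k)" "k < m + 1"
    show "\<not> s (x - int m + int k)" using *(1)[rule_format, of "m - k"] *(2) by (simp add: of_nat_diff algebra_simps)
  qed
  then show ?thesis by (simp only: occurs_at_zeros)
qed

text \<open>A discrete continuity equation: in the frame moving by one site, the change of the occupation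
  number is the difference of the fluxes \<open>of_bool (clear m s _)\<close> at the two ends of the site.\<close>
lemma fi_step_clear:
  assumes "m \<ge> 1"
  shows "of_bool (fi_step m s x) + of_bool (clear m s (x - int m)) =
         (of_bool (s (x + 1)) + of_bool (clear m s (x - int m + 1)) :: int)"
proof -
  have Z1: "clear m s (x - int m + 1) \<longleftrightarrow> \<not> s (x + 1) \<and> (\<forall>k<m. \<not> s (x - int k))"
  proof -
    have "clear m s (x + 1 - int m) \<longleftrightarrow> (\<forall>k<Suc m. \<not> s (x + 1 - int k))"
      unfolding clear_iff by (simp add: less_Suc_eq_le)
    also have "\<dots> \<longleftrightarrow> \<not> s (x + 1) \<and> (\<forall>k<m. \<not> s (x - int k))"
      by (subst All_less_Suc2) simp
    finally show ?thesis by (simp add: algebra_simps)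
  qed
  have Z0: "clear m s (x - int m) \<longleftrightarrow> (\<forall>k<m. \<not> s (x - int k)) \<and> \<not> s (x - int m)"
    unfolding clear_iff by (auto simp: le_less)
  show ?thesis
  proof (cases "\<exists>j\<le>m. s (x - int j)")
    case False
    then have "\<not> fi_step m s x" using assms by (auto simp: fi_step_def)
    moreover have "\<not> s (x - int k)" if "k \<le> m" for k using False that by blast
    ultimately show ?thesis unfolding Z0 Z1 by auto
  next
    case True
    \<comment> \<open>The distance back from \<open>x\<close> to the nearest car, the only car that
      can occupy \<open>x\<close> after the step.\<close>
    define j where "j = (LEAST j. s (x - int j))"
    have sj: "s (x - int j)" unfolding j_def using True by (auto intro: LeastI)
    have jl: "\<not> s (x - int k)" if "k < j" for k using that unfolding j_def by (rule not_less_Least)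
    have jm: "j \<le> m" unfolding j_def using True by (meson Least_le order_trans)
    \<comment> \<open>For \<open>j = 0\<close> the car stays iff it is blocked; otherwise it reaches
      \<open>x\<close> iff the speed limit or a car at \<open>x + 1\<close> stops it there. As
      \<open>m >= 1\<close>, one formula covers both.\<close>
    have "fi_step m s x \<longleftrightarrow> (if j = m then True else s (x + 1))"
    proof (cases "j = 0")
      case True
      then show ?thesis using sj assms by (auto simp: fi_step_def)
    next
      case False
      then have "\<not> s x" using jl[of 0] by simp
      moreover have first: "s (x - int i) \<and> (\<forall>k<i. \<not> s (x - int k)) \<longleftrightarrow> i = j" for i
        by (rule linorder_cases[of i j]) (use sj jl in blast)+
      moreover have "j \<in> {1..m}" using False jm by simp
      ultimately show ?thesis unfolding fi_step_def conj_assoc[symmetric] first by auto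
    qed
    moreover have "(\<forall>k<m. \<not> s (x - int k)) \<longleftrightarrow> j = m"
    proof
      assume *: "\<forall>k<m. \<not> s (x - int k)"
      have "\<not> j < m" using * sj by blast
      then show "j = m" using jm by simp
    qed (use jl in blast)
    ultimately show ?thesis unfolding Z0 Z1 using sj by (cases "j = m") (simp_all, blast)
  qed
qed

text \<open>Summing \<open>fi_step_clear\<close> over \<open>n\<close> sites telescopes, leaving
  only the fluxes at the two ends.\<close>

lemma cars_fi_step:
  assumes "m \<ge> 1"
  shows "cars (fi_step m s) (a + int m) n =
         cars s (a + int m + 1) n + of_bool (clear m s (a + int n)) - of_bool (clear m s a)"
proof (induction n)
  case (Suc n)
  have "of_bool (fi_step m s (a + int m + int n)) + of_bool (clear m s (a + int n)) =
        (of_bool (s (a + int m + int n + 1)) + of_bool (clear m s (a + int n + 1)) :: int)"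
    using fi_step_clear[OF assms, of s "a + int m + int n"] by (simp add: algebra_simps)
  moreover have "cars s b (Suc n) = cars s b n + of_bool (s (b + int n))" for s b
    by (simp add: cars_def)
  ultimately show ?case using Suc by (simp add: algebra_simps)
qed simp

text \<open>Induction on time: if \<open>c k\<close> is the number of cars in the first \<open>k\<close> windows, one step of the
  automaton replaces it by \<open>c (Suc k) - c 1\<close> plus the boundary terms of \<open>cars_fi_step\<close>.\<close>
lemma clear_funpow_iff:
  assumes "m \<ge> 1"
  shows "clear m ((fi_step m ^^ t) s) (a + int m * int t) \<longleftrightarrow>
         (\<forall>k\<in>{1..t+1}. cars s a ((m + 1) * k) < int k)"
proof (induction t arbitrary: s a)
  case 0
  show ?case using cars_nonneg[of s a "m + 1"] cars_eq_0_iff[of s a "m + 1"] by auto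
next
  case (Suc t)
  define c where "c k = cars s a ((m + 1) * k)" for k
  have c0: "c 0 = 0" by (simp add: c_def)
  have c_Suc: "c (Suc k) = c k + cars s (a + int ((m + 1) * k)) (m + 1)" for k
    using cars_add[of s a "(m + 1) * k" "m + 1"] by (simp add: c_def algebra_simps)
  have c_mono: "c k \<le> c (Suc k)" for k
    using c_Suc cars_nonneg[of s "a + int ((m + 1) * k)" "m + 1"] by simp
  have clear_c: "clear m s (a + int ((m + 1) * k)) \<longleftrightarrow> c (Suc k) = c k" for k
    unfolding c_Suc cars_eq_0_iff[symmetric] by simp
  have clear0: "clear m s a \<longleftrightarrow> c 1 = 0" using clear_c[of 0] c0 by simp
  have step: "cars (fi_step m s) (a + int m) ((m + 1) * k) =
      c (Suc k) - c 1 + of_bool (c (Suc k) = c k) - of_bool (c 1 = 0)" for k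
  proof -
    have "c (Suc k) = c 1 + cars s (a + int m + 1) ((m + 1) * k)"
      using cars_add[of s a "m + 1" "(m + 1) * k"] by (simp add: c_def algebra_simps)
    then show ?thesis
      unfolding cars_fi_step[OF assms] clear_c clear0 by simp
  qed
  have "clear m ((fi_step m ^^ Suc t) s) (a + int m * int (Suc t)) \<longleftrightarrow>
        clear m ((fi_step m ^^ t) (fi_step m s)) (a + int m + int m * int t)"
    by (simp add: funpow_swap1 algebra_simps)
  also have "\<dots> \<longleftrightarrow> (\<forall>k\<in>{1..t+1}. c (Suc k) - c 1 + of_bool (c (Suc k) = c k) - of_bool (c 1 = 0) < int k)"
    unfolding Suc.IH step ..
  also have "\<dots> \<longleftrightarrow> (\<forall>k\<in>{1..Suc t+1}. c k < int k)"
  proof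
    assume L: "\<forall>k\<in>{1..t+1}. c (Suc k) - c 1 + of_bool (c (Suc k) = c k) - of_bool (c 1 = 0) < int k"
    \<comment> \<open>By monotonicity \<open>c 2 - c 1 + of_bool (c 2 = c 1)\<close> is at least 1,
      so the instance \<open>k = 1\<close> forces \<open>of_bool (c 1 = 0)\<close> to be 1.\<close>
    have c1: "c 1 = 0"
      using bspec[OF L, of 1] c_mono[of 1] by (auto split: if_splits simp: of_bool_def)
    show "\<forall>k\<in>{1..Suc t+1}. c k < int k"
    proof
      fix k assume k: "k \<in> {1..Suc t+1}"
      show "c k < int k"
      proof (cases "k = 1")
        case False
        with k obtain l where "k = Suc l" "l \<in> {1..t+1}" by (cases k) auto
        then show ?thesis using bspec[OF L, of l] c1 by (auto simp: of_bool_def split: if_splits)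
      qed (use c1 in simp)
    qed
  next
    assume R: "\<forall>k\<in>{1..Suc t+1}. c k < int k"
    have c1: "c 1 = 0" using bspec[OF R, of 1] c_mono[of 0] c0 by simp
    show "\<forall>k\<in>{1..t+1}. c (Suc k) - c 1 + of_bool (c (Suc k) = c k) - of_bool (c 1 = 0) < int k"
    proof
      fix k assume "k \<in> {1..t+1}"
      \<comment> \<open>If \<open>c (Suc k) = c k\<close>, the indicator adds one and the sharper
        bound \<open>c k < k\<close> pays for it.\<close>
      then show "c (Suc k) - c 1 + of_bool (c (Suc k) = c k) - of_bool (c 1 = 0) < int k"
        using bspec[OF R, of k] bspec[OF R, of "Suc k"] c1 by (auto simp: of_bool_def)
    qed
  qed
  finally show ?case by (simp add: c_def)
qed

section \<open>The random walk and its records\<close>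

text \<open>The random walk read leftwards from the origin: a window of \<open>m + 1\<close> sites with \<open>c\<close> cars
  is a step by \<open>1 - c\<close>.\<close>
definition excess :: "nat \<Rightarrow> (int \<Rightarrow> bool) \<Rightarrow> nat \<Rightarrow> int" where
  "excess m s j = int j - cars s (- int ((m + 1) * j)) ((m + 1) * j)"

lemma excess_0 [simp]: "excess m s 0 = 0"
  by (simp add: excess_def)

text \<open>Steps \<open>j + 1\<close> to \<open>j + k\<close> of the walk read the leftmost
  \<open>(m + 1) * k\<close> sites of its first \<open>j + k\<close> windows.\<close>

lemma excess_diff:
  "excess m s (j + k) - excess m s j = int k - cars s (- int ((m + 1) * (j + k))) ((m + 1) * k)"
  using cars_add[of s "- int ((m + 1) * (j + k))" "(m + 1) * k" "(m + 1) * j"]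
  by (simp add: excess_def algebra_simps)

lemma excess_Suc_le: "excess m s (Suc j) \<le> excess m s j + 1"
  using excess_diff[of m s j 1] cars_nonneg[of s "- int ((m + 1) * (j + 1))" "(m + 1) * 1"] by simp

text \<open>With \<open>j + k = t + 1\<close>, the first \<open>k\<close> windows from the left end
  are the last \<open>k\<close> steps of the walk; fewer than \<open>k\<close> cars there means that
  these steps gain height.\<close>

lemma record_iff:
  "(\<forall>k\<in>{1..t+1}. cars s (- int ((m + 1) * Suc t)) ((m + 1) * k) < int k) \<longleftrightarrow>
   (\<forall>j\<le>t. excess m s j < excess m s (Suc t))"
proof -
  have *: "cars s (- int ((m + 1) * Suc t)) ((m + 1) * k) < int k \<longleftrightarrow> excess m s j < excess m s (Suc t)"
    if "j + k = Suc t" for j k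
    using excess_diff[of m s j k] that by auto
  show ?thesis
  proof (intro iffI ballI allI impI)
    fix j assume "\<forall>k\<in>{1..t+1}. cars s (- int ((m + 1) * Suc t)) ((m + 1) * k) < int k" "j \<le> t"
    moreover from \<open>j \<le> t\<close> have "Suc t - j \<in> {1..t+1}" "j + (Suc t - j) = Suc t" by auto
    ultimately show "excess m s j < excess m s (Suc t)" using * by blast
  next
    fix k assume "\<forall>j\<le>t. excess m s j < excess m s (Suc t)" "k \<in> {1..t+1}"
    then show "cars s (- int ((m + 1) * Suc t)) ((m + 1) * k) < int k" using *[of "Suc t - k" k] by auto
  qed
qed

text \<open>As \<open>f\<close> never rises by more than one, each new record raises the maximum by exactly one.\<close>
lemma sum_records_eq_Max:
  fixes f :: "nat \<Rightarrow> int"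
  assumes "f 0 = 0" and "\<And>n. f (Suc n) \<le> f n + 1"
  shows "(\<Sum>t<N. of_bool (\<forall>j\<le>t. f j < f (Suc t))) = Max (f ` {..N})"
proof (induction N)
  case (Suc N)
  let ?M = "Max (f ` {..N})"
  have "Max (f ` {..Suc N}) = max (f (Suc N)) ?M"
    by (simp add: atMost_Suc)
  moreover have "max (f (Suc N)) ?M = ?M + of_bool (?M < f (Suc N))"
  proof -
    have "f N \<le> ?M" by simp
    with assms(2)[of N] have "f (Suc N) \<le> ?M + 1" by linarith
    then show ?thesis by (cases "?M < f (Suc N)") (simp_all del: Max_less_iff)
  qed
  moreover have "(\<forall>j\<le>N. f j < f (Suc N)) \<longleftrightarrow> ?M < f (Suc N)"
    by (subst Max_less_iff) (simp_all, simp add: Ball_def)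
  ultimately show ?case
    using Suc by (simp del: sum_of_bool_eq Max_less_iff)
qed (simp add: assms)

section \<open>Block probabilities and the flow\<close>

lemma occurs_at_Cons: "occurs_at (x # b) s i \<longleftrightarrow> s i = x \<and> occurs_at b s (i + 1)"
  unfolding occurs_at_def by (simp add: All_less_Suc2 algebra_simps)

lemma occurs_at_snoc: "occurs_at (b @ [x]) s i \<longleftrightarrow> occurs_at b s i \<and> s (i + int (length b)) = x"
  unfolding occurs_at_def by (auto simp: All_less_Suc nth_append)

context
  fixes \<rho> :: real
begin

interpretation prob_space "initial_measure \<rho>"
  by (rule prob_space_initial_measure)

lemma expectation_of_bool:
  assumes [measurable]: "Measurable.pred (initial_measure \<rho>) P"
  shows "integrable (initial_measure \<rho>) (\<lambda>s. of_bool (P s) :: real)"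
    and "expectation (\<lambda>s. of_bool (P s)) = prob {s. P s}"
proof -
  have [measurable]: "{s. P s} \<in> events"
    using assms unfolding pred_def by simp
  have "(\<lambda>s. of_bool (P s) :: real) = indicator {s. P s}"
    by (auto simp: indicator_def)
  then show "integrable (initial_measure \<rho>) (\<lambda>s. of_bool (P s) :: real)"
    and "expectation (\<lambda>s. of_bool (P s)) = prob {s. P s}"
    by (simp_all add: emeasure_eq_measure)
qed

lemma pred_occurs_at [measurable]:
  "Measurable.pred (initial_measure \<rho>) (\<lambda>s. occurs_at b ((fi_step m ^^ t) s) i)"
  unfolding occurs_at_def by measurable

lemma expectation_occurs_at:
  "expectation (\<lambda>s. of_bool (occurs_at b ((fi_step m ^^ t) s) i)) = block_prob m \<rho> t b"
  using block_prob_at[of \<rho> b t m i] by (simp add: expectation_of_bool)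

lemma integrable_occurs_at:
  "integrable (initial_measure \<rho>) (\<lambda>s. of_bool (occurs_at b ((fi_step m ^^ t) s) i) :: real)"
  by (simp add: expectation_of_bool)

text \<open>By translation invariance the three blocks of the pointwise identity may sit at
  different sites.\<close>

lemma block_prob_add:
  assumes "\<And>s. of_bool (occurs_at b (s :: int \<Rightarrow> bool) i) =
             (of_bool (occurs_at c s j) + of_bool (occurs_at d s k) :: real)"
  shows "block_prob m \<rho> t b = block_prob m \<rho> t c + block_prob m \<rho> t d"
proof -
  have "block_prob m \<rho> t b = expectation (\<lambda>s. of_bool (occurs_at b ((fi_step m ^^ t) s) i))"
    by (simp add: expectation_occurs_at)
  also have "\<dots> = block_prob m \<rho> t c + block_prob m \<rho> t d"
    unfolding assms by (simp add: expectation_occurs_at integrable_occurs_at)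
  finally show ?thesis .
qed

lemma block_prob_Cons:
  "block_prob m \<rho> t b = block_prob m \<rho> t (True # b) + block_prob m \<rho> t (False # b)"
  by (rule block_prob_add[where i = 1 and j = 0 and k = 0]) (auto simp: occurs_at_Cons)

lemma block_prob_snoc:
  "block_prob m \<rho> t b = block_prob m \<rho> t (b @ [True]) + block_prob m \<rho> t (b @ [False])"
  by (rule block_prob_add[where i = 0 and j = 0 and k = 0]) (auto simp: occurs_at_snoc)

lemma block_prob_Nil: "block_prob m \<rho> t [] = 1"
  using prob_space by (simp add: block_prob_def occurs_at_def)

text \<open>The blocks in the flow formula have probabilities that are first and second differences
  of P_t(0^k) in k, so summation by parts leaves P_t(0) - P_t(0^(m+1)).\<close>

lemma average_flow_eq:
  assumes "m \<ge> 1"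
  shows "average_flow m \<rho> t =
         1 - block_prob m \<rho> t [True] - block_prob m \<rho> t (replicate (m + 1) False)"
proof -
  define z where "z k = block_prob m \<rho> t (replicate k False)" for k
  have q: "block_prob m \<rho> t ([True] @ replicate k False) = z k - z (k + 1)" for k
    using block_prob_Cons[of m t "replicate k False"] by (simp add: z_def)
  have r: "block_prob m \<rho> t ([True] @ replicate k False @ [True]) =
           (z k - z (k + 1)) - (z (k + 1) - z (k + 2))" for k
    using block_prob_snoc[of m t "[True] @ replicate k False"] q[of k] q[of "k + 1"]
    by (simp add: replicate_append_same)
  \<comment> \<open>Only the summation limit becomes \<open>n\<close>: \<open>z\<close> still
    belongs to the fixed speed \<open>m\<close>.\<close>
  have "(\<Sum>k\<in>{1..<n}. real k * ((z k - z (k + 1)) - (z (k + 1) - z (k + 2)))) +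
        real n * (z n - z (n + 1)) = z 1 - z (n + 1)" if "n \<ge> 1" for n
    using that
  proof (induction n rule: nat_induct_at_least)
    case (Suc n)
    then show ?case by (simp add: algebra_simps)
  qed simp
  from this[OF assms] have "average_flow m \<rho> t = z 1 - z (m + 1)"
    unfolding average_flow_def q r by simp
  moreover have "z 1 = 1 - block_prob m \<rho> t [True]"
    using block_prob_Cons[of m t "[]"] by (simp add: z_def block_prob_Nil)
  ultimately show ?thesis by (simp add: z_def)
qed

text \<open>In the expectation of \<open>fi_step_clear\<close> the two fluxes cancel by translation
  invariance.\<close>

lemma block_prob_True_Suc:
  assumes "m \<ge> 1"
  shows "block_prob m \<rho> (Suc t) [True] = block_prob m \<rho> t [True]"
proof -
  let ?s = "\<lambda>t s. (fi_step m ^^ t) s"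
  let ?Z = "replicate (m + 1) False"
  have T: "occurs_at [True] s i \<longleftrightarrow> s i" for s i by (simp add: occurs_at_def)
  have "of_bool (occurs_at [True] (?s (Suc t) s) (int m)) + of_bool (clear m (?s t s) 0) =
        (of_bool (occurs_at [True] (?s t s) (int m + 1)) + of_bool (clear m (?s t s) 1) :: real)" for s
    using arg_cong[OF fi_step_clear[OF assms, of "?s t s" "int m"], of real_of_int] by (simp add: T)
  then have "expectation (\<lambda>s. of_bool (occurs_at [True] (?s (Suc t) s) (int m)) + of_bool (clear m (?s t s) 0) :: real) =
        expectation (\<lambda>s. of_bool (occurs_at [True] (?s t s) (int m + 1)) + of_bool (clear m (?s t s) 1))"
    by (simp only:)
  then have "block_prob m \<rho> (Suc t) [True] + block_prob m \<rho> t ?Z = block_prob m \<rho> t [True] + block_prob m \<rho> t ?Z"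
    by (simp only: Bochner_Integration.integral_add[OF integrable_occurs_at integrable_occurs_at]
                   expectation_occurs_at)
  then show ?thesis by simp
qed

section \<open>Block probabilities as record probabilities\<close>

lemma measurable_cars [measurable]:
  "(\<lambda>s. cars s a n) \<in> measurable (initial_measure \<rho>) (count_space UNIV)"
proof (induction n)
  case (Suc n)
  note Suc [measurable]
  have *: "cars s a (Suc n) = cars s a n + (if s (a + int n) then 1 else 0)" for s
    by (simp add: cars_def)
  show ?case unfolding * by measurable
qed simp

lemma measurable_excess [measurable]:
  "(\<lambda>s. excess m s j) \<in> measurable (initial_measure \<rho>) (count_space UNIV)"
  unfolding excess_def by measurable

text \<open>The left end \<open>a\<close> is free by translation invariance: \<open>a = 0\<close>
  nests the events for different \<open>t\<close>, while \<open>a = - (m + 1) * (t + 1)\<close>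
  makes them records of one walk.\<close>

lemma prob_clear_eq:
  assumes "m \<ge> 1"
  shows "block_prob m \<rho> t (replicate (m + 1) False) =
         prob {s. \<forall>k\<in>{1..t+1}. cars s a ((m + 1) * k) < int k}"
  using block_prob_at[of \<rho> "replicate (m + 1) False" t m "a + int m * int t"]
  by (simp only: clear_funpow_iff[OF assms] space_initial_measure) simp

lemma prob_clear_decreasing:
  assumes "m \<ge> 1" "t \<le> u"
  shows "block_prob m \<rho> u (replicate (m + 1) False) \<le> block_prob m \<rho> t (replicate (m + 1) False)"
  unfolding prob_clear_eq[OF assms(1), of _ 0]
proof (rule finite_measure_mono)
  have "Measurable.pred (initial_measure \<rho>) (\<lambda>s. \<forall>k\<in>{1..t+1}. cars s 0 ((m + 1) * k) < int k)"
    by measurable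
  then show "{s. \<forall>k\<in>{1..t+1}. cars s 0 ((m + 1) * k) < int k} \<in> events"
    by (simp add: pred_def)
qed (use assms(2) in auto)

lemma sum_prob_clear:
  assumes "m \<ge> 1"
  shows "integrable (initial_measure \<rho>) (\<lambda>s. real_of_int (Max (excess m s ` {..N})))"
    and "expectation (\<lambda>s. real_of_int (Max (excess m s ` {..N}))) =
         (\<Sum>t<N. block_prob m \<rho> t (replicate (m + 1) False))"
proof -
  define R where "R t s \<longleftrightarrow> (\<forall>j\<le>t. excess m s j < excess m s (Suc t))" for t s
  have [measurable]: "Measurable.pred (initial_measure \<rho>) (R t)" for t
    unfolding R_def by measurable
  have M: "real_of_int (Max (excess m s ` {..N})) = (\<Sum>t<N. of_bool (R t s))" for s
    using arg_cong[OF sum_records_eq_Max[of "excess m s" N, OF excess_0 excess_Suc_le], of real_of_int]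
    by (simp add: R_def)
  have p: "prob {s. R t s} = block_prob m \<rho> t (replicate (m + 1) False)" for t
    unfolding prob_clear_eq[OF assms, of _ "- int ((m + 1) * Suc t)"] record_iff R_def ..
  show "integrable (initial_measure \<rho>) (\<lambda>s. real_of_int (Max (excess m s ` {..N})))"
    and "expectation (\<lambda>s. real_of_int (Max (excess m s ` {..N}))) =
         (\<Sum>t<N. block_prob m \<rho> t (replicate (m + 1) False))"
    unfolding M p[symmetric] by (simp_all add: expectation_of_bool del: sum_of_bool_eq)
qed

section \<open>Independence and concentration\<close>

lemma distr_site: "distr (initial_measure \<rho>) (bernoulli_pmf \<rho>) (\<lambda>s. s i) = bernoulli_pmf \<rho>"
  unfolding initial_measure_def
  by (rule distr_PiM_component) (auto simp: measure_pmf.prob_space_axioms)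

context
  assumes \<rho>: "0 \<le> \<rho>" "\<rho> \<le> 1"
begin

lemma prob_site: "prob {s. s i} = \<rho>"
proof -
  have "prob {s. s i} = measure (distr (initial_measure \<rho>) (bernoulli_pmf \<rho>) (\<lambda>s. s i)) {True}"
    by (subst measure_distr) (auto simp: vimage_def)
  then show ?thesis using \<rho> by (simp add: distr_site measure_pmf_single)
qed

lemma block_prob_True: "m \<ge> 1 \<Longrightarrow> block_prob m \<rho> t [True] = \<rho>"
proof (induction t)
  case 0
  show ?case using prob_site[of 0] by (simp add: block_prob_def occurs_at_def)
qed (simp add: block_prob_True_Suc)

text \<open>The joint law of the coordinates is the measure itself, which is the product of the
  marginals.\<close>

lemma indep_sites: "indep_vars (\<lambda>_. borel) (\<lambda>i s. of_bool (s i) :: real) UNIV"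
proof -
  have "indep_vars (\<lambda>_. measure_pmf (bernoulli_pmf \<rho>)) (\<lambda>i s. s i) UNIV"
  proof (subst indep_vars_iff_distr_eq_PiM')
    have "distr (initial_measure \<rho>) (initial_measure \<rho>) (\<lambda>x. x) = initial_measure \<rho>"
      by (rule distr_id)
    then show "distr (initial_measure \<rho>) (\<Pi>\<^sub>M i\<in>UNIV. measure_pmf (bernoulli_pmf \<rho>)) (\<lambda>x. \<lambda>i\<in>UNIV. x i) =
      (\<Pi>\<^sub>M i\<in>UNIV. distr (initial_measure \<rho>) (measure_pmf (bernoulli_pmf \<rho>)) (\<lambda>s. s i))"
      by (simp add: distr_site) (simp add: initial_measure_def restrict_def)
  qed auto
  then show ?thesis
    by (rule indep_vars_compose2) simp
qed

lemma expectation_cars: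
  "integrable (initial_measure \<rho>) (\<lambda>s. real_of_int (cars s a n))"
  "expectation (\<lambda>s. real_of_int (cars s a n)) = real n * \<rho>"
  by (simp_all add: cars_def expectation_of_bool prob_site del: sum_of_bool_eq)

lemma expectation_excess:
  "integrable (initial_measure \<rho>) (\<lambda>s. real_of_int (excess m s j))"
  "expectation (\<lambda>s. real_of_int (excess m s j)) = real j * (1 - (real m + 1) * \<rho>)"
  using prob_space by (simp_all add: excess_def expectation_cars algebra_simps)

text \<open>Hoeffding's inequality for \<open>n\<close> independent variables in [0, 1]; few cars
  means a high walk.\<close>

lemma cars_tail:
  assumes "n > 0" "\<epsilon> \<ge> 0"
  shows "prob {s. real_of_int (cars s a n) \<le> real n * \<rho> - \<epsilon>} \<le> exp (- 2 * \<epsilon>\<^sup>2 / real n)"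
proof -
  let ?I = "{a..<a + int n}"
  have I: "?I = (\<lambda>k. a + int k) ` {..<n}"
  proof
    show "?I \<subseteq> (\<lambda>k. a + int k) ` {..<n}"
    proof
      fix x assume "x \<in> ?I"
      then show "x \<in> (\<lambda>k. a + int k) ` {..<n}"
        by (intro image_eqI[of _ _ "nat (x - a)"]) auto
    qed
  qed auto
  have sum_I: "(\<Sum>i\<in>?I. of_bool (s i)) = real_of_int (cars s a n)" for s
    unfolding I cars_def by (subst sum.reindex) (auto simp: inj_on_def simp del: sum_of_bool_eq)
  interpret Hoeffding_ineq "initial_measure \<rho>" ?I "\<lambda>i s. of_bool (s i)" "\<lambda>_. 0" "\<lambda>_. 1" "real n * \<rho>"
    using indep_vars_subset[OF indep_sites]
    by unfold_locales (simp_all add: expectation_of_bool prob_site)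
  show ?thesis
    using Hoeffding_ineq_le[of \<epsilon>] assms unfolding sum_I by simp
qed

section \<open>Averages and the limit\<close>

text \<open>The maximum dominates the walk at \<open>j = 0\<close> and \<open>j = N\<close>, where
  the means are 0 and N(1 - (m + 1) \<rho>).\<close>

lemma sum_prob_clear_ge:
  assumes "m \<ge> 1"
  shows "real N * max 0 (1 - (real m + 1) * \<rho>) \<le>
         (\<Sum>t<N. block_prob m \<rho> t (replicate (m + 1) False))"
proof -
  have "expectation (\<lambda>s. real_of_int (excess m s j)) \<le>
        expectation (\<lambda>s. real_of_int (Max (excess m s ` {..N})))" if "j \<le> N" for j
    using that by (intro integral_mono expectation_excess sum_prob_clear[OF assms]) simp
  from this[of 0] this[of N] show ?thesis
    unfolding expectation_excess sum_prob_clear[OF assms] by (auto simp: max_def)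
qed

text \<open>Unless some event \<open>B j\<close> occurs, the first term bounds the maximum;
  otherwise the trivial bound \<open>N\<close> serves, at a cost controlled by
  \<open>cars_tail\<close> and a union bound.\<close>

lemma sum_prob_clear_le:
  assumes "m \<ge> 1" "N > 0" "\<delta> \<ge> 0"
  shows "(\<Sum>t<N. block_prob m \<rho> t (replicate (m + 1) False)) \<le>
         real N * (max 0 (1 - (real m + 1) * \<rho>) + \<delta>) +
         real N * (real N * exp (- 2 * \<delta>\<^sup>2 * real N / (real m + 1)))"
proof -
  define \<mu> where "\<mu> = 1 - (real m + 1) * \<rho>"
  \<comment> \<open>The margin \<open>N * \<delta>\<close>, not \<open>j * \<delta>\<close>, makes
    the tail bound uniform in \<open>j\<close>: it is weakest at \<open>j = N\<close>.\<close>
  define B where "B j s \<longleftrightarrow> real_of_int (excess m s j) \<ge> real j * \<mu> + real N * \<delta>" for j s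
  have [measurable]: "Measurable.pred (initial_measure \<rho>) (B j)" for j
    unfolding B_def by measurable
  have pB: "prob {s. B j s} \<le> exp (- 2 * \<delta>\<^sup>2 * real N / (real m + 1))" if j: "j \<in> {1..N}" for j
  proof -
    let ?n = "(m + 1) * j"
    have "prob {s. B j s} = prob {s. real_of_int (cars s (- int ?n) ?n) \<le> real ?n * \<rho> - real N * \<delta>}"
      by (intro arg_cong[of _ _ prob]) (auto simp: B_def excess_def \<mu>_def algebra_simps)
    also have "\<dots> \<le> exp (- 2 * (real N * \<delta>)\<^sup>2 / real ?n)"
      using j assms by (intro cars_tail) auto
    also have "\<dots> \<le> exp (- 2 * \<delta>\<^sup>2 * real N / (real m + 1))"
    proof -
      have "real ?n \<le> (real m + 1) * real N"
        using j by (simp add: algebra_simps mult_mono add_mono)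
      then have "2 * (real N * \<delta>)\<^sup>2 / ((real m + 1) * real N) \<le> 2 * (real N * \<delta>)\<^sup>2 / real ?n"
        using j by (intro divide_left_mono mult_pos_pos) (auto simp: add_pos_nonneg)
      moreover have "2 * (real N * \<delta>)\<^sup>2 = 2 * \<delta>\<^sup>2 * real N * real N"
        by (simp add: power2_eq_square)
      then have "2 * (real N * \<delta>)\<^sup>2 / ((real m + 1) * real N) = 2 * \<delta>\<^sup>2 * real N / (real m + 1)"
        using assms by simp
      ultimately show ?thesis by simp
    qed
    finally show ?thesis .
  qed
  have bound: "real_of_int (Max (excess m s ` {..N})) \<le>
      real N * (max 0 \<mu> + \<delta>) + real N * (\<Sum>j\<in>{1..N}. of_bool (B j s))" for s
  proof -
    have "Max (excess m s ` {..N}) \<in> excess m s ` {..N}" by (intro Max_in) auto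
    then obtain j where j: "j \<le> N" "Max (excess m s ` {..N}) = excess m s j"
      by (meson atMost_iff imageE)
    have nn: "0 \<le> real N * (max 0 \<mu> + \<delta>)" using assms by simp
    have nn': "0 \<le> real N * (\<Sum>j\<in>{1..N}. of_bool (B j s))"
      by (intro mult_nonneg_nonneg sum_nonneg) auto
    show ?thesis
    proof (cases "j \<in> {1..N} \<and> B j s")
      case True
      have "excess m s j \<le> int N"
        using cars_nonneg[of s "- int ((m + 1) * j)" "(m + 1) * j"] j by (simp add: excess_def)
      then have "real_of_int (excess m s j) \<le> real N * 1" by simp
      also have "1 \<le> (\<Sum>j\<in>{1..N}. of_bool (B j s) :: real)"
        using True member_le_sum[of j "{1..N}" "\<lambda>j. of_bool (B j s) :: real"]
        by (auto simp del: sum_of_bool_eq)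
      finally show ?thesis using nn j by (simp add: mult_left_mono del: sum_of_bool_eq)
    next
      case False
      have "real j * \<mu> \<le> real j * max 0 \<mu>" by (intro mult_left_mono) auto
      also have "\<dots> \<le> real N * max 0 \<mu>" using j by (intro mult_right_mono) auto
      finally have le: "real j * \<mu> + real N * \<delta> \<le> real N * (max 0 \<mu> + \<delta>)"
        by (simp add: distrib_left)
      have "real_of_int (excess m s j) \<le> real N * (max 0 \<mu> + \<delta>)"
      \<comment> \<open>The events start at \<open>j = 1\<close> because \<open>cars_tail\<close>
        needs a nonempty window; at 0 the walk vanishes.\<close>
      proof (cases "j = 0")
        case True
        then show ?thesis using nn by simp
      next
        case nz: False
        then have "\<not> B j s" using False j by simp
        then show ?thesis using le by (simp add: B_def)
      qed
      then show ?thesis using nn' j by linarith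
    qed
  qed
  have "(\<Sum>t<N. block_prob m \<rho> t (replicate (m + 1) False)) \<le>
        expectation (\<lambda>s. real N * (max 0 \<mu> + \<delta>) + real N * (\<Sum>j\<in>{1..N}. of_bool (B j s)))"
    unfolding sum_prob_clear(2)[OF assms(1), symmetric]
    by (intro integral_mono sum_prob_clear[OF assms(1)] bound)
       (simp_all add: expectation_of_bool del: sum_of_bool_eq)
  also have "\<dots> = real N * (max 0 \<mu> + \<delta>) + real N * (\<Sum>j\<in>{1..N}. prob {s. B j s})"
    using prob_space by (simp add: expectation_of_bool del: sum_of_bool_eq)
  also have "(\<Sum>j\<in>{1..N}. prob {s. B j s}) \<le> real N * exp (- 2 * \<delta>\<^sup>2 * real N / (real m + 1))"
    using sum_bounded_above[of "{1..N}" "\<lambda>j. prob {s. B j s}", OF pB] by simp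
  finally show ?thesis unfolding \<mu>_def by (simp add: mult_left_mono)
qed

text \<open>Were the decreasing sequence too small at \<open>M\<close>, its sums would grow at most
  like \<open>N\<close> times that value, up to the constant \<open>M\<close>, contradicting
  \<open>sum_prob_clear_ge\<close> for large \<open>N\<close>.\<close>

lemma prob_clear_ge:
  assumes "m \<ge> 1"
  shows "max 0 (1 - (real m + 1) * \<rho>) \<le> block_prob m \<rho> M (replicate (m + 1) False)"
proof (rule ccontr)
  let ?\<mu> = "max 0 (1 - (real m + 1) * \<rho>)"
  let ?p = "\<lambda>t. block_prob m \<rho> t (replicate (m + 1) False)"
  assume "\<not> ?\<mu> \<le> ?p M"
  then have pos: "?\<mu> - ?p M > 0" by linarith
  obtain N where N: "real M < real N * (?\<mu> - ?p M)"
    using reals_Archimedean3[OF pos] by blast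
  have le: "(\<Sum>t<n. ?p t) \<le> real M + real n * ?p M" for n
  proof (induction n)
    case (Suc n)
    show ?case
    proof (cases "n < M")
      case True
      have "(\<Sum>t<Suc n. ?p t) \<le> real (Suc n) * 1"
        using sum_bounded_above[of "{..<Suc n}" ?p 1] by (simp add: block_prob_def)
      also have "\<dots> \<le> real M" using True by simp
      also have "\<dots> \<le> real M + real (Suc n) * ?p M" by (simp add: block_prob_def)
      finally show ?thesis .
    next
      case False
      then have "?p n \<le> ?p M" using assms by (intro prob_clear_decreasing) auto
      then show ?thesis using Suc by (simp add: algebra_simps)
    qed
  qed (simp add: block_prob_def)
  show False
    using le[of N] sum_prob_clear_ge[OF assms, of N] N by (simp add: algebra_simps)
qed

text \<open>The lower bound is \<open>prob_clear_ge\<close>; for the upper one, a decreasing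
  sequence lies below its running averages, which \<open>sum_prob_clear_le\<close> bounds.\<close>

lemma prob_clear_tendsto:
  assumes "m \<ge> 1"
  shows "(\<lambda>t. block_prob m \<rho> t (replicate (m + 1) False)) \<longlonglongrightarrow> max 0 (1 - (real m + 1) * \<rho>)"
proof (rule order_tendstoI)
  let ?\<mu> = "max 0 (1 - (real m + 1) * \<rho>)"
  let ?p = "\<lambda>t. block_prob m \<rho> t (replicate (m + 1) False)"
  fix a assume "a < ?\<mu>"
  then have "a < ?p t" for t using prob_clear_ge[OF assms, of t] by linarith
  then show "\<forall>\<^sub>F t in sequentially. a < ?p t"
    by (intro always_eventually allI)
next
  let ?\<mu> = "max 0 (1 - (real m + 1) * \<rho>)"
  let ?p = "\<lambda>t. block_prob m \<rho> t (replicate (m + 1) False)"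
  fix a assume a: "?\<mu> < a"
  \<comment> \<open>Half the gap: one \<open>\<delta>\<close> is the margin in
    \<open>sum_prob_clear_le\<close>, the other absorbs its exponential term.\<close>
  define \<delta> where "\<delta> = (a - ?\<mu>) / 2"
  define c where "c = exp (- 2 * \<delta>\<^sup>2 / (real m + 1))"
  have \<delta>: "\<delta> > 0" using a by (simp add: \<delta>_def)
  have "norm c < 1" using \<delta> by (simp add: c_def)
  then have "(\<lambda>n. real n * c ^ n) \<longlonglongrightarrow> 0"
    using powser_times_n_limit_0[of c] by simp
  then have "\<forall>\<^sub>F n in sequentially. real n * c ^ n < \<delta>"
    using \<delta> by (rule order_tendstoD)
  then have "\<forall>\<^sub>F n in sequentially. real (Suc n) * c ^ Suc n < \<delta>"
    by (rule eventually_sequentially_Suc[THEN iffD2])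
  then show "\<forall>\<^sub>F t in sequentially. ?p t < a"
  proof (rule eventually_mono)
    fix n assume n: "real (Suc n) * c ^ Suc n < \<delta>"
    have "real (Suc n) * ?p n \<le> (\<Sum>t<Suc n. ?p t)"
      using sum_bounded_below[of "{..<Suc n}" "?p n" ?p] prob_clear_decreasing[OF assms] by simp
    also have "\<dots> \<le> real (Suc n) * (?\<mu> + \<delta>) +
        real (Suc n) * (real (Suc n) * exp (- 2 * \<delta>\<^sup>2 * real (Suc n) / (real m + 1)))"
      using \<delta> by (intro sum_prob_clear_le[OF assms]) auto
    also have "exp (- 2 * \<delta>\<^sup>2 * real (Suc n) / (real m + 1)) = c ^ Suc n"
      unfolding c_def exp_of_nat_mult[symmetric] by (simp only: times_divide_eq_right mult_ac)
    also have "real (Suc n) * (?\<mu> + \<delta>) + real (Suc n) * (real (Suc n) * c ^ Suc n) =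
        real (Suc n) * (?\<mu> + \<delta> + real (Suc n) * c ^ Suc n)"
      by (simp only: distrib_left)
    finally have "?p n \<le> ?\<mu> + \<delta> + real (Suc n) * c ^ Suc n"
      by (rule mult_left_le_imp_le) simp
    also have "\<dots> < ?\<mu> + \<delta> + \<delta>" using n by (rule add_strict_left_mono)
    also have "\<dots> = a" by (simp add: \<delta>_def)
    finally show "?p n < a" .
  qed
qed

end

end

theorem mainTheorem2:
  fixes m :: nat and \<rho> :: real
  assumes "m \<ge> 1" and "0 \<le> \<rho>" and "\<rho> \<le> 1"
  shows "(\<lambda>t. block_prob m \<rho> t (replicate (m + 1) False)) \<longlonglongrightarrow>
           (if \<rho> < 1 / (real m + 1) then 1 - (real m + 1) * \<rho> else 0) \<and>
         (\<lambda>t. average_flow m \<rho> t) \<longlonglongrightarrow>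
           (if \<rho> < 1 / (real m + 1) then real m * \<rho> else 1 - \<rho>)"
proof
  have \<mu>: "max 0 (1 - (real m + 1) * \<rho>) = (if \<rho> < 1 / (real m + 1) then 1 - (real m + 1) * \<rho> else 0)"
    by (auto simp: field_simps max_def)
  show lim: "(\<lambda>t. block_prob m \<rho> t (replicate (m + 1) False)) \<longlonglongrightarrow>
           (if \<rho> < 1 / (real m + 1) then 1 - (real m + 1) * \<rho> else 0)"
    using prob_clear_tendsto[OF assms(2,3,1)] unfolding \<mu> .
  have "(\<lambda>t. 1 - \<rho> - block_prob m \<rho> t (replicate (m + 1) False)) \<longlonglongrightarrow>
        1 - \<rho> - (if \<rho> < 1 / (real m + 1) then 1 - (real m + 1) * \<rho> else 0)"
    by (intro tendsto_intros lim)
  also have "1 - \<rho> - (if \<rho> < 1 / (real m + 1) then 1 - (real m + 1) * \<rho> else 0) =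
      (if \<rho> < 1 / (real m + 1) then real m * \<rho> else 1 - \<rho>)"
    by (simp add: algebra_simps)
  finally show "(\<lambda>t. average_flow m \<rho> t) \<longlonglongrightarrow>
           (if \<rho> < 1 / (real m + 1) then real m * \<rho> else 1 - \<rho>)"
    unfolding average_flow_eq[OF assms(1)] block_prob_True[OF assms(2,3,1)] .
qed

end
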